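(* Let $m,n\ge 2$ be integers and $\mathcal{A}\in\mathbb{R}^{[m,n]}$. The following two statements are equivalent: (a) The tensor $\mathcal{A}$ is R$_0$; (b) The solution map $\mathrm{Sol}:\mathbb{R}^{[m,n]}\times\mathbb{R}^n\rightrightarrows\mathbb{R}^n$ is upper semicontinuous at $(\mathcal{A},a)$, for every $a\in\mathbb{R}^n$ satisfying $\mathrm{Sol}(\mathcal{A},a)\neq\emptyset$.
   Context: $\mathbb{R}^{[m,n]}$ is the real vector space (of dimension $n^m$) of real $m$-th order $n$-dimensional tensors $\mathcal{A}=(a_{i_1\cdots i_m})$, $i_j\in[n]=\{1,\dots,n\}$, with the Frobenius norm $\|\mathcal{A}\|=\sqrt{\sum a_{i_1\cdots i_m}^2}$; $\mathbb{R}^{[m,n]}\times\mathbb{R}^n$ carries the norm $\|(\mathcal{A},a)\|=\sqrt{\|\mathcal{A}\|^2+\sum_i a_i^2}$. For $x\in\mathbb{R}^n$, $\mathcal{A}x^{m-1}\in\mathbb{R}^n$ has components $(\mathcal{A}x^{m-1})_i=\sum_{i_2,\dots,i_m=1}^n a_{ii_2\cdots i_m}x_{i_2}\cdots x_{i_m}$, and $\mathcal{A}x^m=\langle x,\mathcal{A}x^{m-1}\rangle$. For $a\in\mathbb{R}^n$, $\mathrm{Sol}(\mathcal{A},a)$ is the solution set of the tensor complementarity problem $\mathrm{TCP}(\mathcal{A},a)$, i.e. the set of $x\in\mathbb{R}^n$ with $x\ge 0$, $\mathcal{A}x^{m-1}+a\ge 0$, $\mathcal{A}x^m+\langle x,a\rangle=0$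 (inequalities componentwise). The solution map is the set-valued map $(\mathcal{A},a)\mapsto\mathrm{Sol}(\mathcal{A},a)$. $\mathcal{A}$ is an R$_0$-tensor (is R$_0$) if $\mathrm{Sol}(\mathcal{A},0)=\{0\}$. A set-valued map $\Psi$ is upper semicontinuous at $x$ if for any open set $V$ with $\Psi(x)\subset V$ there exists a neighborhood $U$ of $x$ such that $\Psi(x')\subset V$ for all $x'\in U$. *)

theory Defs
  imports "HOL-Analysis.Analysis"
begin

text \<open>
  A real tensor of order \<open>m = CARD('m)\<close> and dimension \<open>n = CARD('n)\<close> is a family of reals indexed by
  all index tuples \<open>'m \<Rightarrow> 'n\<close>. The library norm on this type is the square root of the sum of the
  squares of all entries, i.e. the Frobenius norm, and the library norm on the product with
  \<open>real ^ 'n\<close> is the square root of the sum of the two squared norms. The linear order on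
  \<open>'m\<close> only serves to single out the first index position.
\<close>

type_synonym ('m, 'n) tensor = "real ^ ('m \<Rightarrow> 'n)"

definition first_pos :: "'m::{finite,linorder}" where
  "first_pos = Min UNIV"

text \<open>
  The vector \<open>A x\<^sup>m\<^sup>-\<^sup>1\<close>: summing over all tuples whose first entry is \<open>i\<close> is summing over
  \<open>i\<^sub>2, \<dots>, i\<^sub>m\<close>.
\<close>

definition tensor_app :: "('m::{finite,linorder}, 'n::finite) tensor \<Rightarrow> real ^ 'n \<Rightarrow> real ^ 'n" where
  "tensor_app A x =
     (\<chi> i. \<Sum>f | f first_pos = i. A $ f * (\<Prod>k\<in>UNIV - {first_pos}. x $ f k))"

definition tensor_form :: "('m::{finite,linorder}, 'n::finite) tensor \<Rightarrow> real ^ 'n \<Rightarrow> real" where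
  "tensor_form A x = x \<bullet> tensor_app A x"

definition Sol :: "('m::{finite,linorder}, 'n::finite) tensor \<Rightarrow> real ^ 'n \<Rightarrow> (real ^ 'n) set" where
  "Sol A a = {x. (\<forall>i. 0 \<le> x $ i) \<and> (\<forall>i. 0 \<le> (tensor_app A x + a) $ i) \<and>
                 tensor_form A x + x \<bullet> a = 0}"

definition R0_tensor :: "('m::{finite,linorder}, 'n::finite) tensor \<Rightarrow> bool" where
  "R0_tensor A \<longleftrightarrow> Sol A 0 = {0}"

definition upper_semicontinuous_at ::
    "('a::topological_space \<Rightarrow> 'b::topological_space set) \<Rightarrow> 'a \<Rightarrow> bool" where
  "upper_semicontinuous_at \<Psi> x \<longleftrightarrow>
     (\<forall>V. open V \<and> \<Psi> x \<subseteq> V \<longrightarrow> (\<exists>U. open U \<and> x \<in> U \<and> (\<forall>x'\<in>U. \<Psi> x' \<subseteq> V)))"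

end

(* If A is R0, points of Sol (B, b) for (B, b) near (A, a) are controlled by homogenization: with
   s = 1 / (1 + |x|) and y = s x the pair (s, y) lies in the compact set |y| + s = 1, and y solves
   TCP (B, s^(m-1) b). In the limit s = 0 would give a nonzero element of Sol (A, 0), so s > 0 and
   x itself accumulates at a point of Sol (A, a).

   Conversely, let y be a nonzero element of Sol (A, 0) and let C be a tensor with
   C y^(m-1) = (1, ..., 1). Then t y solves TCP (A - t^(1-m) C, (1, ..., 1)) for all t > 0, while no
   such point solves TCP (A, (1, ..., 1)); letting t tend to infinity contradicts upper
   semicontinuity at (A, (1, ..., 1)). *)

theory Submission
  imports Defs
begin

lemma tensor_app_scaleR:
  fixes A :: "('m::{finite,linorder}, 'n::finite) tensor"
  shows "tensor_app A (t *\<^sub>R x) = t ^ (CARD('m) - 1) *\<^sub>R tensor_app A x"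
proof -
  have "card (UNIV - {first_pos :: 'm}) = CARD('m) - 1"
    by (simp add: card_Diff_singleton)
  then show ?thesis
    by (simp add: tensor_app_def vec_eq_iff prod.distrib sum_distrib_left mult_ac)
qed

lemma tensor_app_diff_scaleR:
  "tensor_app (A - c *\<^sub>R B) x = tensor_app A x - c *\<^sub>R tensor_app B x"
  by (simp add: tensor_app_def vec_eq_iff left_diff_distrib sum_subtractf sum_distrib_left mult.assoc)

lemma tendsto_tensor_app:
  assumes "(B \<longlongrightarrow> A) F" "(X \<longlongrightarrow> x) F"
  shows "((\<lambda>i. tensor_app (B i) (X i)) \<longlongrightarrow> tensor_app A x) F"
  unfolding tensor_app_def
  by (intro tendsto_intros assms)

lemma Sol_iff:
  "x \<in> Sol A a \<longleftrightarrow> (\<forall>i. 0 \<le> x $ i) \<and> (\<forall>i. 0 \<le> (tensor_app A x + a) $ i) \<and>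
     x \<bullet> (tensor_app A x + a) = 0"
  by (simp add: Sol_def tensor_form_def inner_add_right)

text \<open>Homogeneity of degree m - 1: with \<open>a\<close> scaled by
  \<open>t ^ (CARD('m) - 1)\<close>, the whole vector \<open>tensor_app A x + a\<close> is
  multiplied by that positive factor, so signs and orthogonality survive.\<close>

lemma Sol_scaleR_iff:
  fixes A :: "('m::{finite,linorder}, 'n::finite) tensor"
  assumes "t > 0"
  shows "t *\<^sub>R x \<in> Sol A (t ^ (CARD('m) - 1) *\<^sub>R a) \<longleftrightarrow> x \<in> Sol A a"
proof -
  have "tensor_app A (t *\<^sub>R x) + t ^ (CARD('m) - 1) *\<^sub>R a
      = t ^ (CARD('m) - 1) *\<^sub>R (tensor_app A x + a)"
    by (simp add: tensor_app_scaleR scaleR_add_right)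
  moreover have "0 \<le> t ^ (CARD('m) - 1) * r \<longleftrightarrow> 0 \<le> r" "0 \<le> t * r \<longleftrightarrow> 0 \<le> r" for r
    using assms by (simp_all add: zero_le_mult_iff power_le_zero_eq)
  ultimately show ?thesis
    using assms unfolding Sol_iff by (simp del: vector_add_component)
qed

text \<open>All defining conditions are weak inequalities or equations between functions jointly
  continuous in tensor, vector and point, so they pass to limits.\<close>

lemma Sol_closed_graph:
  assumes "B \<longlonglongrightarrow> A" "b \<longlonglongrightarrow> a" "X \<longlonglongrightarrow> x"
    and "\<And>n. X n \<in> Sol (B n) (b n)"
  shows "x \<in> Sol A a"
proof -
  have app: "(\<lambda>n. tensor_app (B n) (X n) + b n) \<longlonglongrightarrow> tensor_app A x + a"
    by (intro tendsto_add tendsto_tensor_app assms)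
  have sol: "0 \<le> X n $ i" "0 \<le> (tensor_app (B n) (X n) + b n) $ i"
    "X n \<bullet> (tensor_app (B n) (X n) + b n) = 0" for n i
    using assms(4)[of n] unfolding Sol_iff by auto
  have "0 \<le> x $ i" for i
    using sol(1) by (intro LIMSEQ_le_const[OF tendsto_vec_nth[OF assms(3)]]) blast
  moreover have "0 \<le> (tensor_app A x + a) $ i" for i
    using sol(2) by (intro LIMSEQ_le_const[OF tendsto_vec_nth[OF app]]) blast
  moreover have "x \<bullet> (tensor_app A x + a) = 0"
    using tendsto_inner[OF assms(3) app] sol(3) by (simp add: LIMSEQ_const_iff)
  ultimately show ?thesis
    unfolding Sol_iff by blast
qed

text \<open>For m at least 2 the products in \<open>tensor_app A 0\<close> are nonempty, so this
  vector vanishes; for m = 1 it would be \<open>A\<close> itself.\<close>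

lemma zero_in_Sol:
  fixes A :: "('m::{finite,linorder}, 'n::finite) tensor"
  assumes "CARD('m) \<ge> 2" and "\<And>i. 0 \<le> a $ i"
  shows "0 \<in> Sol A a"
proof -
  have "tensor_app A 0 = 0"
    using tensor_app_scaleR[of A 0 0] assms(1) by (simp add: power_0_left)
  then show ?thesis
    using assms(2) by (simp add: Sol_iff)
qed

text \<open>The compactness behind upper semicontinuity: solutions of nearby problems cannot escape
  to infinity, although no bound on \<open>X\<close> is assumed.\<close>

lemma R0_tensor_imp_Sol_accumulation:
  fixes A :: "('m::{finite,linorder}, 'n::finite) tensor"
  assumes "CARD('m) \<ge> 2" and "R0_tensor A"
    and "B \<longlonglongrightarrow> A" "b \<longlonglongrightarrow> a" and sol: "\<And>n. X n \<in> Sol (B n) (b n)"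
  obtains r x where "strict_mono (r :: nat \<Rightarrow> nat)" "(X \<circ> r) \<longlonglongrightarrow> x" "x \<in> Sol A a"
proof -
  define s where "s n = 1 / (1 + norm (X n))" for n
  define y where "y n = s n *\<^sub>R X n" for n
  have s_pos: "s n > 0" for n
    unfolding s_def by (simp add: add_pos_nonneg)
  have norm_y: "norm (y n) + s n = 1" for n
    using s_pos[of n] unfolding y_def s_def
    by (simp add: add_divide_distrib[symmetric] add_pos_nonneg add_nonneg_eq_0_iff)
  have mem: "(s n, y n) \<in> {0..1} \<times> cball 0 1" for n
    using s_pos[of n] norm_y[of n] norm_ge_zero[of "y n"] by (simp del: norm_ge_zero)
  have "seq_compact ({0..1::real} \<times> cball (0 :: real ^ 'n) 1)"
    by (intro compact_imp_seq_compact compact_Times) auto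
  from seq_compactE[OF this allI, of "\<lambda>n. (s n, y n)", OF mem]
  obtain l r where r: "strict_mono (r :: nat \<Rightarrow> nat)"
    and lim: "((\<lambda>n. (s n, y n)) \<circ> r) \<longlonglongrightarrow> l"
    by blast
  define \<sigma> \<eta> where "\<sigma> = fst l" and "\<eta> = snd l"
  then have \<sigma>: "(\<lambda>n. s (r n)) \<longlonglongrightarrow> \<sigma>" and \<eta>: "(\<lambda>n. y (r n)) \<longlonglongrightarrow> \<eta>"
    using tendsto_fst[OF lim] tendsto_snd[OF lim] by (simp_all add: comp_def)
  have Br: "(\<lambda>n. B (r n)) \<longlonglongrightarrow> A" and br: "(\<lambda>n. b (r n)) \<longlonglongrightarrow> a"
    using LIMSEQ_subseq_LIMSEQ[OF _ r] assms(3,4) by (auto simp: comp_def)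
  \<comment> \<open>The normalization survives in the limit, so \<open>\<sigma> = 0\<close> would
    make \<open>\<eta>\<close> a unit vector.\<close>
  have norm_\<eta>: "norm \<eta> + \<sigma> = 1"
    using tendsto_add[OF tendsto_norm[OF \<eta>] \<sigma>] by (simp add: norm_y LIMSEQ_const_iff)
  have \<eta>_sol: "\<eta> \<in> Sol A (\<sigma> ^ (CARD('m) - 1) *\<^sub>R a)"
  proof (rule Sol_closed_graph[OF Br _ \<eta>])
    show "(\<lambda>n. s (r n) ^ (CARD('m) - 1) *\<^sub>R b (r n)) \<longlonglongrightarrow> \<sigma> ^ (CARD('m) - 1) *\<^sub>R a"
      by (intro tendsto_intros \<sigma> br)
    show "y (r n) \<in> Sol (B (r n)) (s (r n) ^ (CARD('m) - 1) *\<^sub>R b (r n))" for n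
      unfolding y_def using Sol_scaleR_iff[OF s_pos] sol by blast
  qed
  have "\<sigma> \<noteq> 0"
  proof
    assume "\<sigma> = 0"
    \<comment> \<open>Here m at least 2 matters: it makes \<open>0 ^ (CARD('m) - 1)\<close> equal to
      0 rather than 1.\<close>
    then have "\<eta> \<in> Sol A 0"
      using \<eta>_sol assms(1) by (simp add: power_0_left)
    then show False
      using norm_\<eta> \<open>\<sigma> = 0\<close> assms(2) by (simp add: R0_tensor_def)
  qed
  moreover have "\<sigma> \<ge> 0"
    using less_imp_le[OF s_pos] by (intro LIMSEQ_le_const[OF \<sigma>]) blast
  ultimately have "\<sigma> > 0"
    by simp
  \<comment> \<open>Undoing the scaling recovers \<open>X\<close> along the subsequence, now with a
    finite limit.\<close>
  have "(\<lambda>n. inverse (s (r n)) *\<^sub>R y (r n)) \<longlonglongrightarrow> inverse \<sigma> *\<^sub>R \<eta>"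
    by (intro tendsto_intros \<sigma> \<eta> \<open>\<sigma> \<noteq> 0\<close>)
  moreover have "inverse (s n) *\<^sub>R y n = X n" for n
    using s_pos[of n] by (simp add: y_def)
  ultimately have "(X \<circ> r) \<longlonglongrightarrow> inverse \<sigma> *\<^sub>R \<eta>"
    by (simp add: comp_def)
  moreover have "inverse \<sigma> *\<^sub>R \<eta> \<in> Sol A a"
    using \<eta>_sol Sol_scaleR_iff[OF \<open>\<sigma> > 0\<close>, of "inverse \<sigma> *\<^sub>R \<eta>" A a] \<open>\<sigma> \<noteq> 0\<close> by simp
  ultimately show thesis
    using that r by blast
qed

text \<open>Otherwise balls shrinking to \<open>(A, a)\<close> yield solutions outside
  \<open>V\<close>. They accumulate at a point of \<open>Sol A a\<close>, which lies in
  \<open>V\<close>, yet the complement of \<open>V\<close> is closed.\<close>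

lemma R0_tensor_imp_upper_semicontinuous:
  fixes A :: "('m::{finite,linorder}, 'n::finite) tensor"
  assumes "CARD('m) \<ge> 2" and "R0_tensor A"
  shows "upper_semicontinuous_at (\<lambda>(B :: ('m, 'n) tensor, b :: real ^ 'n). Sol B b) (A, a)"
  unfolding upper_semicontinuous_at_def
proof (intro allI impI, elim conjE, rule ccontr)
  fix V :: "(real ^ 'n) set"
  assume V: "open V" "(case (A, a) of (B, b) \<Rightarrow> Sol B b) \<subseteq> V"
  assume no_nbhd: "\<not> (\<exists>U. open U \<and> (A, a) \<in> U \<and> (\<forall>z\<in>U. (case z of (B, b) \<Rightarrow> Sol B b) \<subseteq> V))"
  have "\<exists>B b x. dist (B, b) (A, a) < inverse (real (Suc n)) \<and> x \<in> Sol B b \<and> x \<notin> V" for n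
  proof -
    let ?U = "ball (A, a) (inverse (real (Suc n)))"
    have "\<not> (\<forall>z\<in>?U. (case z of (B, b) \<Rightarrow> Sol B b) \<subseteq> V)"
      using no_nbhd by (metis centre_in_ball inverse_positive_iff_positive of_nat_0_less_iff open_ball
          zero_less_Suc)
    then obtain z where "z \<in> ?U" "\<not> (case z of (B, b) \<Rightarrow> Sol B b) \<subseteq> V"
      by blast
    then show ?thesis
      by (cases z) (auto simp: dist_commute)
  qed
  then obtain B b X where dist: "\<And>n. dist (B n, b n) (A, a) < inverse (real (Suc n))"
    and X: "\<And>n. X n \<in> Sol (B n) (b n)" "\<And>n. X n \<notin> V"
    by metis
  have "(\<lambda>n. dist (B n, b n) (A, a)) \<longlonglongrightarrow> 0"
    by (rule tendsto_sandwich[OF _ _ tendsto_const LIMSEQ_inverse_real_of_nat])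
      (use dist in \<open>auto intro!: always_eventually less_imp_le\<close>)
  then have "(\<lambda>n. (B n, b n)) \<longlonglongrightarrow> (A, a)"
    by (simp add: tendsto_dist_iff[symmetric])
  then have "B \<longlonglongrightarrow> A" and "b \<longlonglongrightarrow> a"
    using tendsto_fst tendsto_snd by fastforce+
  then obtain r x where "strict_mono (r :: nat \<Rightarrow> nat)" "(X \<circ> r) \<longlonglongrightarrow> x" "x \<in> Sol A a"
    by (rule R0_tensor_imp_Sol_accumulation[OF assms _ _ X(1)])
  moreover have "closed (- V)"
    using V(1) by (simp add: closed_open)
  ultimately show False
    using X(2) V(2) closed_sequentially[of "- V" "X \<circ> r" x] by auto
qed

text \<open>Fix \<open>j\<close> with \<open>y $ j\<close> nonzero and let \<open>C\<close> be
  supported on the index tuples (i, j, ..., j). Component i then has a single term, with the nonzero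
  factor \<open>p\<close>, the power m - 1 of \<open>y $ j\<close>.\<close>

lemma ex_tensor_app_eq:
  fixes y v :: "real ^ 'n"
  assumes "y \<noteq> 0"
  obtains C :: "('m::{finite,linorder}, 'n::finite) tensor" where "tensor_app C y = v"
proof -
  obtain j where j: "y $ j \<noteq> 0"
    using assms by (auto simp: vec_eq_iff)
  define p where "p = (\<Prod>k\<in>UNIV - {first_pos :: 'm}. y $ j)"
  have "p \<noteq> 0"
    using j by (simp add: p_def)
  define C :: "('m, 'n) tensor"
    where "C = (\<chi> f. if f = (\<lambda>_. j)(first_pos := f first_pos) then v $ (f first_pos) / p else 0)"
  have "tensor_app C y $ i = v $ i" for i
  proof -
    let ?g = "(\<lambda>_. j)(first_pos := i) :: 'm \<Rightarrow> 'n"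
    have "tensor_app C y $ i
        = (\<Sum>f | f first_pos = i. if f = ?g then v $ i / p * (\<Prod>k\<in>UNIV - {first_pos}. y $ f k) else 0)"
      unfolding tensor_app_def C_def vec_lambda_beta by (intro sum.cong refl) auto
    also have "\<dots> = v $ i / p * (\<Prod>k\<in>UNIV - {first_pos}. y $ ?g k)"
      by (subst sum.delta) auto
    also have "(\<Prod>k\<in>UNIV - {first_pos}. y $ ?g k) = p"
      unfolding p_def by (intro prod.cong) auto
    finally show ?thesis
      using \<open>p \<noteq> 0\<close> by simp
  qed
  then show thesis
    using that[of C] by (simp add: vec_eq_iff)
qed

text \<open>The all-ones vector \<open>1\<close> serves as test vector because it has positive inner
  product with every nonzero nonnegative \<open>y\<close>.\<close>

lemma upper_semicontinuous_imp_R0_tensor: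
  fixes A :: "('m::{finite,linorder}, 'n::finite) tensor"
  assumes m: "CARD('m) \<ge> 2"
    and usc: "upper_semicontinuous_at (\<lambda>(B :: ('m, 'n) tensor, b :: real ^ 'n). Sol B b) (A, 1)"
  shows "R0_tensor A"
proof (rule ccontr)
  assume "\<not> R0_tensor A"
  then obtain y where y: "y \<in> Sol A 0" "y \<noteq> 0"
    using zero_in_Sol[OF m, of 0 A] by (auto simp: R0_tensor_def)
  have y_nonneg: "0 \<le> y $ i" for i
    using y(1) by (simp add: Sol_iff)
  have app_y: "0 \<le> tensor_app A y $ i" "y \<bullet> tensor_app A y = 0" for i
    using y(1) by (simp_all add: Sol_iff)
  obtain C :: "('m, 'n) tensor" where C: "tensor_app C y = 1"
    using ex_tensor_app_eq[OF y(2)] .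
  \<comment> \<open>At \<open>t *\<^sub>R y\<close> the powers of \<open>t\<close> cancel in the
    perturbation, which contributes exactly -1 and so removes the added vector
    \<open>1\<close>.\<close>
  have ray_sol: "t *\<^sub>R y \<in> Sol (A - (inverse t) ^ (CARD('m) - 1) *\<^sub>R C) 1" if "t > 0" for t
  proof -
    have "tensor_app (A - (inverse t) ^ (CARD('m) - 1) *\<^sub>R C) (t *\<^sub>R y) + 1
        = t ^ (CARD('m) - 1) *\<^sub>R tensor_app A y"
      using that
      by (simp add: tensor_app_diff_scaleR tensor_app_scaleR C power_inverse scaleR_diff_right)
    then show ?thesis
      using that y_nonneg app_y unfolding Sol_iff by (simp del: vector_add_component)
  qed
  have "y \<bullet> 1 > 0"
  proof -
    obtain i where "y $ i \<noteq> 0"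
      using y(2) by (auto simp: vec_eq_iff)
    then have "0 < (\<Sum>i\<in>UNIV. y $ i)"
      using y_nonneg by (intro sum_pos2[of _ i]) (auto simp: less_le)
    then show ?thesis
      by (simp add: inner_vec_def)
  qed
  \<comment> \<open>The removed ray starts at \<open>t = 1\<close> to stay away from 0, which does
    belong to \<open>Sol A 1\<close>.\<close>
  define V where "V = - ((\<lambda>t. t *\<^sub>R y) ` {1..})"
  have "open V"
    unfolding V_def using y(2)
    by (intro open_Compl closed_injective_linear_image linear_scaleR_left) (auto simp: inj_def)
  moreover have "Sol A 1 \<subseteq> V"
  proof -
    have "t *\<^sub>R y \<notin> Sol A 1" if "t \<ge> 1" for t
    proof
      \<comment> \<open>Since \<open>y \<bullet> tensor_app A y = 0\<close>, complementarity leaves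
        only the term from the vector \<open>1\<close>.\<close>
      assume "t *\<^sub>R y \<in> Sol A 1"
      then have "t * (y \<bullet> 1) = 0"
        by (simp add: Sol_iff tensor_app_scaleR inner_add_right app_y)
      then show False
        using that \<open>y \<bullet> 1 > 0\<close> by simp
    qed
    then show ?thesis
      unfolding V_def by auto
  qed
  ultimately obtain U where U: "open U" "(A, 1) \<in> U" 
      "\<forall>z\<in>U. (case z of (B, b) \<Rightarrow> Sol B b) \<subseteq> V"
    using usc unfolding upper_semicontinuous_at_def prod.case by blast
  have "((\<lambda>t. (A - (inverse t) ^ (CARD('m) - 1) *\<^sub>R C, 1 :: real ^ 'n))
      \<longlongrightarrow> (A - 0 ^ (CARD('m) - 1) *\<^sub>R C, 1)) at_top"
    by (intro tendsto_intros tendsto_inverse_0_at_top filterlim_ident)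
  then have "((\<lambda>t. (A - (inverse t) ^ (CARD('m) - 1) *\<^sub>R C, 1 :: real ^ 'n)) \<longlongrightarrow> (A, 1)) at_top"
    using m by (simp add: power_0_left)
  then have "\<forall>\<^sub>F t in at_top. (A - (inverse t) ^ (CARD('m) - 1) *\<^sub>R C, 1 :: real ^ 'n) \<in> U"
    using U(1,2) by (rule topological_tendstoD)
  then have "\<forall>\<^sub>F t :: real in at_top. t \<ge> 1 \<and> (A - (inverse t) ^ (CARD('m) - 1) *\<^sub>R C, 1 :: real ^ 'n) \<in> U"
    using eventually_ge_at_top[of 1] by eventually_elim auto
  then obtain t :: real where "t \<ge> 1" "(A - (inverse t) ^ (CARD('m) - 1) *\<^sub>R C, 1 :: real ^ 'n) \<in> U"
    using eventually_happens trivial_limit_at_top_linorder by blast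
  then have "t *\<^sub>R y \<in> V"
    using U(3) ray_sol[of t] by auto
  then show False
    using \<open>t \<ge> 1\<close> by (auto simp: V_def image_iff)
qed

theorem theorem5p1:
  fixes A :: "('m::{finite,linorder}, 'n::finite) tensor"
  assumes "CARD('m) \<ge> 2" and "CARD('n) \<ge> 2"
  shows "R0_tensor A \<longleftrightarrow>
    (\<forall>a. Sol A a \<noteq> {} \<longrightarrow>
       upper_semicontinuous_at
         (\<lambda>(B :: ('m, 'n) tensor, b :: real ^ 'n). Sol B b) (A, a))"
proof
  assume "R0_tensor A"
  then show "\<forall>a. Sol A a \<noteq> {} \<longrightarrow>
      upper_semicontinuous_at (\<lambda>(B :: ('m, 'n) tensor, b :: real ^ 'n). Sol B b) (A, a)"
    using R0_tensor_imp_upper_semicontinuous[OF assms(1)] by blast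
next
  assume "\<forall>a. Sol A a \<noteq> {} \<longrightarrow>
      upper_semicontinuous_at (\<lambda>(B :: ('m, 'n) tensor, b :: real ^ 'n). Sol B b) (A, a)"
  \<comment> \<open>The origin solves the problem at \<open>1\<close>, so the assumed semicontinuity
    is available there.\<close>
  moreover have "Sol A 1 \<noteq> {}"
    using zero_in_Sol[OF assms(1), of 1 A] by auto
  ultimately show "R0_tensor A"
    using upper_semicontinuous_imp_R0_tensor[OF assms(1)] by blast
qed

end
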